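(* Let $A\in\mathbb{R}^{m\times n}$ and let $R\subseteq\mathbb{R}^n$ be a nonempty polyhedron. Then for all $(J,K)\in\mathcal{S}(A\vert R)$ $$H_{J,K}(A)=\max_{y\in\mathbb{R}^m,\ \|y\|\le1}\ \min_{x\in K,\ A_Jx\le y_J}\|x\|=\frac{1}{\displaystyle\min_{v\in\mathbb{R}^J_+,\ \|v\|^*=1,\ u\in\mathbb{R}^n,\ A_J^{\mathsf T}v-u\in K^*}\|u\|^*}.$$ In particular, $$H(A\vert R)=\max_{(J,K)\in\mathcal{S}(A\vert R)}\frac{1}{\displaystyle\min_{v\in\mathbb{R}^J_+,\ \|v\|^*=1,\ u\in\mathbb{R}^n,\ A_J^{\mathsf T}v-u\in K^*}\|u\|^*}.$$
   Context: $\mathbb{R}^n$ and $\mathbb{R}^m$ are each endowed with an arbitrary norm (not necessarily Euclidean), both denoted $\|\cdot\|$, and with the standard inner product. The dual norm is $\|u\|^*:=\max_{\|x\|\le1}\langle u,x\rangle$. For a convex cone $K\subseteq\mathbb{R}^n$, $K^*:=\{u:\langle u,x\rangle\ge0\ \text{for all }x\in K\}$. $[m]=\{1,\dots,m\}$. For $J\subseteq[m]$, $A_J$ is the submatrix of rows indexed by $J$ and $y_J$ the corresponding subvector. For $v\in\mathbb{R}^J_+$, $\|v\|^*$ is the dual norm in $\mathbb{R}^m$ of $v$ extended by zeros outside $J$. A minimum over an empty set (e.g. when $J=\emptyset$) is $+\infty$, and its reciprocal is $0$. For a polyhedron $Q\subseteq\mathbb{R}^d$ and $u\in Q$, the tangent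 cone is $T_Q(u)=\{d\in\mathbb{R}^d: u+td\in Q\text{ for some }t>0\}$, and $\mathcal{T}(Q):=\{T_Q(u):u\in Q\}$, a finite collection. Define $$\mathcal{S}(A\vert R):=\{(J,K): J\subseteq[m],\ K\in\mathcal{T}(R),\ A_J(K)+\mathbb{R}^J_+=\mathbb{R}^J\},$$ $$H_{J,K}(A):=\max_{y\in\mathbb{R}^m,\ \|y\|\le1}\ \min_{x\in K,\ A_Jx\le y_J}\|x\|$$ for $(J,K)\in\mathcal{S}(A\vert R)$, with $H_{J,K}(A):=0$ if $J=\emptyset$ (pairs with $J=\emptyset$ belong to $\mathcal S(A\vert R)$), and $$H(A\vert R):=\max_{(J,K)\in\mathcal{S}(A\vert R)}H_{J,K}(A).$$ *)

theory Defs
  imports "HOL-Analysis.Analysis"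
begin

text \<open>
  The library's \<open>norm\<close> on \<open>real ^ 'n\<close> is the Euclidean one, so an arbitrary norm is an
  explicit function satisfying the norm axioms.
\<close>

definition is_norm :: "('a::real_vector \<Rightarrow> real) \<Rightarrow> bool" where
  "is_norm N \<longleftrightarrow>
     (\<forall>x. 0 \<le> N x) \<and> (\<forall>x. N x = 0 \<longleftrightarrow> x = 0) \<and>
     (\<forall>c x. N (c *\<^sub>R x) = \<bar>c\<bar> * N x) \<and> (\<forall>x y. N (x + y) \<le> N x + N y)"

text \<open>For a norm \<open>N\<close> on a Euclidean space this supremum is finite and attained.\<close>

definition dual_norm :: "('a::euclidean_space \<Rightarrow> real) \<Rightarrow> 'a \<Rightarrow> real" where
  "dual_norm N u = (SUP x\<in>{x. N x \<le> 1}. u \<bullet> x)"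

definition dual_cone :: "'a::real_inner set \<Rightarrow> 'a set" where
  "dual_cone K = {u. \<forall>x\<in>K. 0 \<le> u \<bullet> x}"

definition tangent_cone :: "'a::real_vector set \<Rightarrow> 'a \<Rightarrow> 'a set" where
  "tangent_cone Q u = {d. \<exists>t>0. u + t *\<^sub>R d \<in> Q}"

definition tangent_cones :: "'a::real_vector set \<Rightarrow> 'a set set" where
  "tangent_cones Q = tangent_cone Q ` Q"

text \<open>
  For a set \<open>J\<close> of indices, the space of vectors indexed by \<open>J\<close> is identified, by extension
  with zeros, with the coordinate subspace \<open>coord_space J\<close>. Accordingly \<open>subvec J y\<close> is the
  subvector of \<open>y\<close>, and \<open>submatrix_rows J A\<close> the row submatrix of \<open>A\<close>, with zeros in the
  positions outside \<open>J\<close>.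
\<close>

definition coord_space :: "'m set \<Rightarrow> (real ^ 'm) set" where
  "coord_space J = {v. \<forall>i. i \<notin> J \<longrightarrow> v $ i = 0}"

definition coord_orthant :: "'m set \<Rightarrow> (real ^ 'm) set" where
  "coord_orthant J = {v \<in> coord_space J. \<forall>i\<in>J. 0 \<le> v $ i}"

definition subvec :: "'m set \<Rightarrow> real ^ 'm \<Rightarrow> real ^ 'm" where
  "subvec J y = (\<chi> i. if i \<in> J then y $ i else 0)"

definition submatrix_rows :: "'m set \<Rightarrow> real ^ 'n ^ 'm \<Rightarrow> real ^ 'n ^ 'm" where
  "submatrix_rows J A = (\<chi> i. if i \<in> J then A $ i else 0)"

definition surjective_pairs ::
    "real ^ 'n ^ 'm \<Rightarrow> (real ^ 'n) set \<Rightarrow> ('m set \<times> (real ^ 'n) set) set" where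
  "surjective_pairs A R =
     {(J, K). K \<in> tangent_cones R \<and>
        {submatrix_rows J A *v x + s | x s. x \<in> K \<and> s \<in> coord_orthant J} = coord_space J}"

text \<open>
  The order on \<open>real ^ 'm\<close> is componentwise; outside \<open>J\<close> the inequality reads \<open>0 \<le> 0\<close>.
\<close>

definition primal_feasible ::
    "real ^ 'n ^ 'm \<Rightarrow> 'm set \<Rightarrow> (real ^ 'n) set \<Rightarrow> real ^ 'm \<Rightarrow> (real ^ 'n) set" where
  "primal_feasible A J K y = {x \<in> K. submatrix_rows J A *v x \<le> subvec J y}"

definition dual_feasible ::
    "(real ^ 'm \<Rightarrow> real) \<Rightarrow> real ^ 'n ^ 'm \<Rightarrow> 'm set \<Rightarrow> (real ^ 'n) set
      \<Rightarrow> ((real ^ 'm) \<times> (real ^ 'n)) set" where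
  "dual_feasible N A J K =
     {(v, u). v \<in> coord_orthant J \<and> dual_norm N v = 1 \<and>
        transpose (submatrix_rows J A) *v v - u \<in> dual_cone K}"

text \<open>
  Optimal values are taken in \<open>ereal\<close>, where an infimum over the empty set is \<open>\<infinity>\<close> and
  \<open>1 / \<infinity> = 0\<close>. Below, \<open>N\<close> is the norm on the domain of \<open>A\<close> and \<open>M\<close> the norm on its codomain.
\<close>

definition hoffman_pair ::
    "(real ^ 'n \<Rightarrow> real) \<Rightarrow> (real ^ 'm \<Rightarrow> real) \<Rightarrow> real ^ 'n ^ 'm
      \<Rightarrow> 'm set \<Rightarrow> (real ^ 'n) set \<Rightarrow> ereal" where
  "hoffman_pair N M A J K =
     (if J = {} then 0
      else SUP y\<in>{y. M y \<le> 1}. INF x\<in>primal_feasible A J K y. ereal (N x))"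

definition hoffman ::
    "(real ^ 'n \<Rightarrow> real) \<Rightarrow> (real ^ 'm \<Rightarrow> real) \<Rightarrow> real ^ 'n ^ 'm
      \<Rightarrow> (real ^ 'n) set \<Rightarrow> ereal" where
  "hoffman N M A R = (SUP (J, K)\<in>surjective_pairs A R. hoffman_pair N M A J K)"

end

theory Submission
  imports Defs
begin

text \<open>
  A dual feasible pair \<open>(v, u)\<close> and a primal feasible \<open>x\<close> for the right-hand side \<open>y\<close> satisfy
  \<open>-\<langle>v, y\<rangle> \<le> \<parallel>u\<parallel>\<^sup>* \<parallel>x\<parallel>\<close>. If \<open>r\<close> is the least dual value, attained at \<open>(v, u)\<close>, and \<open>y\<close> is a
  unit vector with \<open>-\<langle>v, y\<rangle> = \<parallel>v\<parallel>\<^sup>* = 1\<close>, this bounds the primal value at \<open>y\<close> from below by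
  \<open>1 / r\<close>, where \<open>r > 0\<close> by surjectivity. Two separation arguments show conversely that no unit
  vector has a primal value above \<open>1 / r\<close>; so the supremum over \<open>y\<close> is attained, without
  appeal to continuity of the primal value.
\<close>

section \<open>Arbitrary norms on a Euclidean space and their dual norms\<close>

lemma
  assumes "is_norm N"
  shows is_norm_nonneg: "0 \<le> N x"
    and is_norm_zero: "N 0 = 0"
    and is_norm_pos: "x \<noteq> 0 \<Longrightarrow> 0 < N x"
    and is_norm_scaleR: "N (c *\<^sub>R x) = \<bar>c\<bar> * N x"
    and is_norm_minus: "N (- x) = N x"
    and is_norm_triangle: "N (x + y) \<le> N x + N y"
proof -
  show "0 \<le> N x" "N 0 = 0" "N (c *\<^sub>R x) = \<bar>c\<bar> * N x" "N (x + y) \<le> N x + N y"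
    using assms by (simp_all add: is_norm_def)
  show "0 < N x" if "x \<noteq> 0"
    using assms that by (metis is_norm_def less_eq_real_def)
  have "N (-1 *\<^sub>R x) = \<bar>-1\<bar> * N x"
    using assms unfolding is_norm_def by blast
  then show "N (- x) = N x"
    by simp
qed

lemma is_norm_convex_on:
  assumes "is_norm N"
  shows "convex_on UNIV N"
proof (rule convex_onI)
  fix t :: real and x y assume "0 < t" "t < 1"
  have "N ((1 - t) *\<^sub>R x + t *\<^sub>R y) \<le> N ((1 - t) *\<^sub>R x) + N (t *\<^sub>R y)"
    by (rule is_norm_triangle[OF assms])
  also have "\<dots> = (1 - t) * N x + t * N y"
    using \<open>0 < t\<close> \<open>t < 1\<close> by (simp add: is_norm_scaleR[OF assms])
  finally show "N ((1 - t) *\<^sub>R x + t *\<^sub>R y) \<le> (1 - t) * N x + t * N y" .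
qed simp

lemma convex_is_norm_ball:
  assumes "is_norm N"
  shows "convex {x. N x \<le> r}"
  unfolding convex_def
proof (clarsimp)
  fix x y and s t :: real
  assume "N x \<le> r" "N y \<le> r" "0 \<le> s" "0 \<le> t" "s + t = 1"
  have "N (s *\<^sub>R x + t *\<^sub>R y) \<le> s * N x + t * N y"
    using is_norm_triangle[OF assms, of "s *\<^sub>R x" "t *\<^sub>R y"] \<open>0 \<le> s\<close> \<open>0 \<le> t\<close>
    by (simp add: is_norm_scaleR[OF assms])
  also have "\<dots> \<le> r"
    by (rule convex_bound_le) fact+
  finally show "N (s *\<^sub>R x + t *\<^sub>R y) \<le> r" .
qed

text \<open>A convex function on an open subset of a finite-dimensional space is continuous, and the
  norm axioms give convexity.\<close>

lemma is_norm_continuous_on: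
  fixes N :: "'a::euclidean_space \<Rightarrow> real"
  assumes "is_norm N"
  shows "continuous_on S N"
  using convex_on_continuous[OF open_UNIV is_norm_convex_on[OF assms]]
  by (rule continuous_on_subset) simp

text \<open>The continuous function \<open>N\<close> has a positive minimum on the compact Euclidean
  unit sphere; its reciprocal serves as \<open>c\<close>.\<close>

lemma is_norm_dominates_norm:
  fixes N :: "'a::euclidean_space \<Rightarrow> real"
  assumes "is_norm N"
  obtains c where "c > 0" "\<And>x. norm x \<le> c * N x"
proof -
  have "\<exists>z\<in>sphere 0 1. \<forall>x\<in>sphere 0 1. N z \<le> N x"
    by (rule continuous_attains_inf) (use is_norm_continuous_on[OF assms] in auto)
  then obtain z :: 'a where z: "norm z = 1" "\<And>x. norm x = 1 \<Longrightarrow> N z \<le> N x"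
    by auto
  have "N z > 0"
    using z(1) by (intro is_norm_pos[OF assms]) auto
  moreover have "norm x \<le> 1 / N z * N x" for x
  proof (cases "x = 0")
    case False
    have "N z \<le> N ((1 / norm x) *\<^sub>R x)"
      using False by (intro z(2)) simp
    also have "\<dots> = N x / norm x"
      by (simp add: is_norm_scaleR[OF assms])
    finally show ?thesis
      using False \<open>N z > 0\<close> by (simp add: field_simps)
  qed (simp add: is_norm_zero[OF assms])
  ultimately show ?thesis
    using that[of "1 / N z"] by simp
qed

lemma compact_is_norm_ball:
  fixes N :: "'a::euclidean_space \<Rightarrow> real"
  assumes "is_norm N"
  shows "compact {x. N x \<le> r}"
proof -
  obtain c where c: "c > 0" "\<And>x. norm x \<le> c * N x"
    using is_norm_dominates_norm[OF assms] by blast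
  have "norm x \<le> c * r" if "N x \<le> r" for x
    using c(2)[of x] mult_left_mono[OF that, of c] c(1) by linarith
  then have "bounded {x. N x \<le> r}"
    by (auto simp: bounded_iff)
  moreover have "closed {x. N x \<le> r}"
    by (intro closed_Collect_le is_norm_continuous_on assms continuous_intros)
  ultimately show ?thesis
    by (simp add: compact_eq_bounded_closed)
qed

text \<open>The set \<open>S\<close> may be unbounded. Cutting it with the \<open>N\<close>-ball
  whose radius is the value at some point \<open>a\<close> of \<open>S\<close> makes it compact and
  loses no minimiser.\<close>

lemma is_norm_arg_min_exists:
  fixes N :: "'a::euclidean_space \<Rightarrow> real"
  assumes "is_norm N" "closed S" "S \<noteq> {}"
  shows "\<exists>x. is_arg_min N (\<lambda>x. x \<in> S) x"
proof -
  obtain a where a: "a \<in> S" using assms(3) by blast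
  have "\<exists>z\<in>{x. N x \<le> N a} \<inter> S. \<forall>x\<in>{x. N x \<le> N a} \<inter> S. N z \<le> N x"
    using a by (intro continuous_attains_inf compact_Int_closed compact_is_norm_ball
        is_norm_continuous_on assms) auto
  then obtain z where "z \<in> S" "N z \<le> N a" "\<And>x. x \<in> S \<Longrightarrow> N x \<le> N a \<Longrightarrow> N z \<le> N x"
    by auto
  then have "is_arg_min N (\<lambda>x. x \<in> S) z"
    unfolding is_arg_min_linorder by (meson linear order_trans)
  then show ?thesis ..
qed

text \<open>Compactness of the unit ball turns the supremum into a maximum, so no default value of
  the real supremum can enter.\<close>

lemma dual_norm_attained:
  fixes N :: "'a::euclidean_space \<Rightarrow> real"
  assumes "is_norm N"
  obtains x where "N x \<le> 1" "u \<bullet> x = dual_norm N u"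
proof -
  have "0 \<in> {x. N x \<le> 1}"
    by (simp add: is_norm_zero[OF assms])
  then have "\<exists>z\<in>{x. N x \<le> 1}. \<forall>x\<in>{x. N x \<le> 1}. u \<bullet> x \<le> u \<bullet> z"
    by (intro continuous_attains_sup compact_is_norm_ball assms continuous_intros) auto
  then obtain z where z: "N z \<le> 1" "\<And>x. N x \<le> 1 \<Longrightarrow> u \<bullet> x \<le> u \<bullet> z"
    by auto
  then have "dual_norm N u = u \<bullet> z"
    unfolding dual_norm_def by (intro cSup_eq_maximum) auto
  with z(1) that show ?thesis by simp
qed

text \<open>The Cauchy-Schwarz inequality for a dual pair of norms, obtained by scaling
  \<open>x\<close> to the unit sphere of \<open>N\<close>.\<close>

lemma inner_le_dual_norm_mult:
  fixes N :: "'a::euclidean_space \<Rightarrow> real"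
  assumes "is_norm N"
  shows "u \<bullet> x \<le> dual_norm N u * N x"
proof (cases "x = 0")
  case False
  have pos: "N x > 0"
    using False by (rule is_norm_pos[OF assms])
  have "compact ((\<bullet>) u ` {x. N x \<le> 1})"
    by (intro compact_continuous_image compact_is_norm_ball assms continuous_intros)
  then have "bdd_above ((\<bullet>) u ` {x. N x \<le> 1})"
    by (intro bounded_imp_bdd_above compact_imp_bounded)
  moreover have "N ((1 / N x) *\<^sub>R x) = 1"
    using pos by (simp add: is_norm_scaleR[OF assms])
  ultimately have "u \<bullet> ((1 / N x) *\<^sub>R x) \<le> dual_norm N u"
    unfolding dual_norm_def by (intro cSup_upper imageI) simp_all
  then show ?thesis
    using pos by (simp add: field_simps)
qed (simp add: is_norm_zero[OF assms])

lemma dual_norm_nonneg: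
  fixes N :: "'a::euclidean_space \<Rightarrow> real"
  assumes "is_norm N"
  shows "0 \<le> dual_norm N u"
proof (cases "u = 0")
  case True
  then show ?thesis
    using dual_norm_attained[OF assms, of u] by (metis inner_zero_left order_refl)
next
  case False
  then have "0 < dual_norm N u * N u"
    using inner_le_dual_norm_mult[OF assms, of u u] by (meson inner_gt_zero_iff less_le_trans)
  moreover have "0 \<le> N u"
    by (rule is_norm_nonneg[OF assms])
  ultimately show ?thesis
    by (simp add: zero_less_mult_iff)
qed

lemma dual_norm_le:
  fixes N :: "'a::euclidean_space \<Rightarrow> real"
  assumes "is_norm N" "0 \<le> c" "\<And>x. u \<bullet> x \<le> c * N x"
  shows "dual_norm N u \<le> c"
proof -
  obtain x where "N x \<le> 1" "u \<bullet> x = dual_norm N u"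
    using dual_norm_attained[OF assms(1)] by blast
  then show ?thesis
    using assms(3)[of x] mult_left_mono[of "N x" 1 c] assms(2) by simp
qed

text \<open>This makes the facts about norms, such as compactness of balls and continuity, available
  for dual norms as well.\<close>

lemma is_norm_dual_norm:
  fixes N :: "'a::euclidean_space \<Rightarrow> real"
  assumes "is_norm N"
  shows "is_norm (dual_norm N)"
proof -
  have zero: "dual_norm N 0 = 0"
    using dual_norm_attained[OF assms, of 0] by (metis inner_zero_left)
  have scale_le: "dual_norm N (c *\<^sub>R u) \<le> \<bar>c\<bar> * dual_norm N u" for c u
  proof (rule dual_norm_le[OF assms])
    fix x
    have "c *\<^sub>R u \<bullet> x = u \<bullet> (c *\<^sub>R x)" by simp
    also have "\<dots> \<le> dual_norm N u * N (c *\<^sub>R x)"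
      by (rule inner_le_dual_norm_mult[OF assms])
    also have "\<dots> = \<bar>c\<bar> * dual_norm N u * N x"
      by (simp add: is_norm_scaleR[OF assms])
    finally show "c *\<^sub>R u \<bullet> x \<le> \<bar>c\<bar> * dual_norm N u * N x" .
  qed (simp add: dual_norm_nonneg[OF assms])
  have scale: "dual_norm N (c *\<^sub>R u) = \<bar>c\<bar> * dual_norm N u" for c u
  proof (cases "c = 0")
    case False
    \<comment> \<open>Undoing the scaling by \<open>c\<close> with the factor \<open>1 / c\<close>
      gives the reverse of \<open>scale_le\<close>.\<close>
    have "dual_norm N u \<le> \<bar>1 / c\<bar> * dual_norm N (c *\<^sub>R u)"
      using scale_le[of "1 / c" "c *\<^sub>R u"] False by simp
    then have "\<bar>c\<bar> * dual_norm N u \<le> dual_norm N (c *\<^sub>R u)"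
      using False by (simp add: field_simps)
    with scale_le[of c u] show ?thesis by simp
  qed (simp add: zero)
  have "u = 0" if "dual_norm N u = 0" for u
    using inner_le_dual_norm_mult[OF assms, of u u] that by (metis inner_gt_zero_iff mult_zero_left not_le)
  moreover have "dual_norm N (u + v) \<le> dual_norm N u + dual_norm N v" for u v
    using inner_le_dual_norm_mult[OF assms, of u] inner_le_dual_norm_mult[OF assms, of v]
    by (intro dual_norm_le[OF assms])
       (auto simp: dual_norm_nonneg[OF assms] inner_add_left distrib_right intro: add_mono)
  ultimately show ?thesis
    unfolding is_norm_def using dual_norm_nonneg[OF assms] zero scale by blast
qed

section \<open>Tangent cones of a polyhedron\<close>

lemma polyhedron_finite_inequalities:
  fixes Q :: "'a::euclidean_space set"
  assumes "polyhedron Q"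
  obtains F where "finite F" "Q = {x. \<forall>(a, b)\<in>F. a \<bullet> x \<le> b}"
proof -
  obtain G where G: "finite G" "Q = \<Inter>G"
    "\<And>h. h \<in> G \<Longrightarrow> \<exists>a b. a \<noteq> 0 \<and> h = {x. a \<bullet> x \<le> b}"
    using assms unfolding polyhedron_def by metis
  then obtain a b where ab: "\<And>h. h \<in> G \<Longrightarrow> h = {x. a h \<bullet> x \<le> b h}"
    by metis
  have "x \<in> \<Inter>G \<longleftrightarrow> (\<forall>(a, b)\<in>(\<lambda>h. (a h, b h)) ` G. a \<bullet> x \<le> b)" for x
    using ab by fastforce
  then show ?thesis
    using that[of "(\<lambda>h. (a h, b h)) ` G"] G by blast
qed

text \<open>Constraints that are slack at \<open>u\<close> stay slack under a small move, by
  continuity, while a tight one only sees the sign of \<open>a \<bullet> d\<close>. As there are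
  finitely many constraints, one step length suits them all.\<close>

lemma tangent_cone_active:
  fixes F :: "('a::euclidean_space \<times> real) set"
  assumes "finite F" and Q: "Q = {x. \<forall>(a, b)\<in>F. a \<bullet> x \<le> b}" and "u \<in> Q"
  shows "tangent_cone Q u = {d. \<forall>(a, b)\<in>{(a, b)\<in>F. a \<bullet> u = b}. a \<bullet> d \<le> 0}"
proof (intro equalityI subsetI)
  fix d assume "d \<in> tangent_cone Q u"
  then obtain t where t: "t > 0" "u + t *\<^sub>R d \<in> Q"
    by (auto simp: tangent_cone_def)
  have "a \<bullet> d \<le> 0" if "(a, b) \<in> F" "a \<bullet> u = b" for a b
  proof -
    have "a \<bullet> (u + t *\<^sub>R d) \<le> b" using t(2) that(1) unfolding Q by blast
    then show ?thesis
      using that(2) t(1) by (simp add: inner_add_right mult_le_0_iff)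
  qed
  then show "d \<in> {d. \<forall>(a, b)\<in>{(a, b)\<in>F. a \<bullet> u = b}. a \<bullet> d \<le> 0}" by auto
next
  fix d assume d: "d \<in> {d. \<forall>(a, b)\<in>{(a, b)\<in>F. a \<bullet> u = b}. a \<bullet> d \<le> 0}"
  have "\<forall>\<^sub>F t in at_right 0. \<forall>p\<in>F. fst p \<bullet> (u + t *\<^sub>R d) \<le> snd p"
  proof (intro eventually_ball_finite ballI assms)
    fix p assume "p \<in> F"
    obtain a b where p: "p = (a, b)" by fastforce
    have le: "a \<bullet> u \<le> b" using \<open>p \<in> F\<close> assms(3) unfolding Q p by blast
    show "\<forall>\<^sub>F t in at_right 0. fst p \<bullet> (u + t *\<^sub>R d) \<le> snd p"
    proof (cases "a \<bullet> u = b")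
      case True
      then have "a \<bullet> d \<le> 0" using d \<open>p \<in> F\<close> p by blast
      then show ?thesis
        using True unfolding p eventually_at_right_field
        by (auto simp: inner_add_right mult_le_0_iff intro!: exI[of _ 1])
    next
      case False
      have "((\<lambda>t. a \<bullet> (u + t *\<^sub>R d)) \<longlongrightarrow> a \<bullet> (u + 0 *\<^sub>R d)) (at_right 0)"
        by (intro tendsto_intros)
      then have "\<forall>\<^sub>F t in at_right 0. a \<bullet> (u + t *\<^sub>R d) < b"
        by (rule order_tendstoD) (use False le in auto)
      then show ?thesis
        unfolding p by eventually_elim simp
    qed
  qed
  moreover have "\<forall>\<^sub>F t in at_right (0::real). 0 < t"
    by (rule eventually_at_right_less)
  ultimately have "\<exists>t. (\<forall>p\<in>F. fst p \<bullet> (u + t *\<^sub>R d) \<le> snd p) \<and> 0 < t"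
    by (intro eventually_happens'[OF trivial_limit_at_right_real] eventually_conj)
  then show "d \<in> tangent_cone Q u"
    unfolding tangent_cone_def Q by force
qed

text \<open>A tangent cone is determined by the set of constraints active at its base point, and
  \<open>F\<close> has only finitely many subsets.\<close>

lemma finite_tangent_cones:
  fixes Q :: "'a::euclidean_space set"
  assumes "polyhedron Q"
  shows "finite (tangent_cones Q)"
proof -
  obtain F where F: "finite F" "Q = {x. \<forall>(a, b)\<in>F. a \<bullet> x \<le> b}"
    using polyhedron_finite_inequalities[OF assms] by blast
  have "tangent_cones Q \<subseteq> (\<lambda>G. {d. \<forall>(a, b)\<in>G. a \<bullet> d \<le> 0}) ` Pow F"
    unfolding tangent_cones_def using tangent_cone_active[OF F] by blast
  then show ?thesis
    using F(1) finite_subset by blast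
qed

lemma tangent_cones_closed_convex_cone:
  fixes Q :: "'a::euclidean_space set"
  assumes "polyhedron Q" "K \<in> tangent_cones Q"
  shows "closed K" "convex K" "cone K" "0 \<in> K"
proof -
  obtain F where F: "finite F" "Q = {x. \<forall>(a, b)\<in>F. a \<bullet> x \<le> b}"
    using polyhedron_finite_inequalities[OF assms(1)] by blast
  obtain u where "u \<in> Q" "K = tangent_cone Q u"
    using assms(2) by (auto simp: tangent_cones_def)
  then obtain G :: "('a \<times> real) set" where K: "K = {d. \<forall>(a, b)\<in>G. a \<bullet> d \<le> 0}"
    using tangent_cone_active[OF F] by blast
  then have K': "K = (\<Inter>p\<in>G. {d. fst p \<bullet> d \<le> 0})" by force
  show "closed K" "convex K"
    unfolding K' by (auto intro!: closed_halfspace_le convex_INT convex_halfspace_le)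
  show "cone K" "0 \<in> K"
    unfolding K by (auto simp: cone_def mult_nonneg_nonpos split: prod.splits)
qed

section \<open>Splitting a linear functional dominated by a norm on a cone\<close>

text \<open>
  A linear functional that is dominated by a norm on a convex cone splits into a bounded part and
  a part in the polar cone: separate the strict epigraph of the norm from the hypograph of the
  functional on the cone.
\<close>

lemma dominated_on_cone_split:
  fixes N :: "'a::euclidean_space \<Rightarrow> real"
  assumes N: "is_norm N" and "0 \<le> c" and K: "convex K" "cone K" "0 \<in> K"
    and le: "\<And>x. x \<in> K \<Longrightarrow> w \<bullet> x \<le> c * N x"
  obtains u where "dual_norm N u \<le> c" "u - w \<in> dual_cone K"
proof -
  define E where "E = {(x, t). c * N x < t}"
  define H where "H = {(x, t). x \<in> K \<and> t \<le> w \<bullet> x}"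
  note N0 = is_norm_zero[OF N]
  have conv: "convex_on UNIV (\<lambda>x. c * N x)"
    by (rule convex_on_cmul[OF \<open>0 \<le> c\<close> is_norm_convex_on[OF N]])
  have "convex E"
    unfolding convex_alt E_def
  proof (clarsimp)
    fix x y :: 'a and s t q :: real
    assume *: "c * N x < s" "c * N y < t" "0 \<le> q" "q \<le> 1"
    have "c * N ((1 - q) *\<^sub>R x + q *\<^sub>R y) \<le> (1 - q) * (c * N x) + q * (c * N y)"
      using convex_onD[OF conv, of q x y] *(3,4) by simp
    also have "\<dots> < (1 - q) * s + q * t"
    proof (cases "q = 0")
      case False
      then have "q * (c * N y) < q * t" using *(2,3) by simp
      moreover have "(1 - q) * (c * N x) \<le> (1 - q) * s" using *(1,4) by (intro mult_left_mono) auto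
      ultimately show ?thesis by linarith
    qed (use *(1) in simp)
    finally show "c * N ((1 - q) *\<^sub>R x + q *\<^sub>R y) < (1 - q) * s + q * t" .
  qed
  moreover have "convex H"
    unfolding convex_alt H_def
    using K(1) by (auto simp: convex_alt inner_add_right intro!: add_mono mult_left_mono)
  moreover have "(0, 1) \<in> E" "(0, 0) \<in> H"
    using K(3) by (auto simp: E_def H_def N0)
  moreover have "E \<inter> H = {}"
    using le by (force simp: E_def H_def)
  ultimately obtain p k where p: "p \<noteq> 0" "\<And>z. z \<in> H \<Longrightarrow> p \<bullet> z \<le> k" "\<And>z. z \<in> E \<Longrightarrow> k \<le> p \<bullet> z"
    using separating_hyperplane_sets[of H E] by (metis Int_commute empty_iff)
  obtain a b where ab: "p = (a, b)" by fastforce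
  have k: "0 \<le> k"
    using p(2)[OF \<open>(0, 0) \<in> H\<close>] by (simp add: ab)
  have E0: "0 \<le> a \<bullet> x + b * t" if "c * N x < t" for x t
    using p(3)[of "(x, t)"] that k by (simp add: ab E_def)
  have "b \<ge> 0"
    using E0[of 0 1] by (simp add: N0)
  \<comment> \<open>The separating hyperplane is not vertical: \<open>E\<close> projects onto the
    whole space, so a vertical one would force \<open>a = 0\<close>.\<close>
  moreover have "b \<noteq> 0"
  proof
    assume "b = 0"
    then have "0 \<le> a \<bullet> (- a)"
      using E0[of "- a" "c * N (- a) + 1"] by simp
    then have "a = 0"
      by (metis inner_gt_zero_iff inner_minus_right neg_0_le_iff_le not_le)
    then show False
      using p(1) \<open>b = 0\<close> by (simp add: ab zero_prod_def)
  qed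
  ultimately have b: "b > 0" by simp
  \<comment> \<open>Letting the height decrease to \<open>c * N x\<close> extends the bound to the
    boundary of the strict epigraph.\<close>
  have epi: "- (a \<bullet> x) \<le> b * (c * N x)" for x
  proof (rule field_le_epsilon)
    fix e :: real assume "e > 0"
    then show "- (a \<bullet> x) \<le> b * (c * N x) + e"
      using E0[of x "c * N x + e / b"] b by (simp add: distrib_left)
  qed
  \<comment> \<open>Points of \<open>E\<close> above the origin come arbitrarily close to it, so the
    hyperplane can be taken through the origin.\<close>
  have "k \<le> 0"
  proof (rule field_le_epsilon)
    fix e :: real assume "e > 0"
    then show "k \<le> 0 + e"
      using p(3)[of "(0, e / b)"] b by (simp add: ab E_def N0)
  qed
  have hyp: "b * (w \<bullet> x) \<le> - (a \<bullet> x)" if "x \<in> K" for x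
    using p(2)[of "(x, w \<bullet> x)"] that \<open>k \<le> 0\<close> by (simp add: ab H_def)
  show ?thesis
  proof
    \<comment> \<open>Dividing by \<open>b\<close> makes the hyperplane the graph of a linear
      functional, which lies below the norm and, on \<open>K\<close>, above
      \<open>w\<close>.\<close>
    show "dual_norm N (- (1 / b) *\<^sub>R a) \<le> c"
      using epi b by (intro dual_norm_le[OF N \<open>0 \<le> c\<close>]) (simp add: field_simps)
    show "- (1 / b) *\<^sub>R a - w \<in> dual_cone K"
      using hyp b by (simp add: dual_cone_def inner_diff_left field_simps)
  qed
qed

section \<open>Primal and dual feasible sets: closedness, nonemptiness and attainment\<close>

lemma inner_transpose_matrix_vector:
  fixes B :: "real ^ 'n ^ 'm"
  shows "(transpose B *v v) \<bullet> x = v \<bullet> (B *v x)"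
  by (subst transpose_matrix_vector) (rule dot_lmul_matrix)

lemma INF_ereal_is_arg_min:
  assumes "is_arg_min f (\<lambda>x. x \<in> S) z"
  shows "(INF x\<in>S. ereal (f x)) = ereal (f z)"
  using assms unfolding is_arg_min_linorder
  by (intro antisym INF_lower INF_greatest) auto

lemma coord_orthant_nonneg: "v \<in> coord_orthant J \<Longrightarrow> 0 \<le> v $ i"
  by (cases "i \<in> J") (auto simp: coord_orthant_def coord_space_def)

lemma coord_orthant_inner_nonneg:
  fixes v s :: "real ^ 'm"
  shows "v \<in> coord_orthant J \<Longrightarrow> s \<in> coord_orthant J \<Longrightarrow> 0 \<le> v \<bullet> s"
  by (simp add: inner_vec_def sum_nonneg coord_orthant_nonneg)

lemma closed_coord_orthant: "closed (coord_orthant J :: (real ^ 'm) set)"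
proof -
  have "coord_orthant J =
      {v :: real ^ 'm. (\<forall>i. i \<notin> J \<longrightarrow> v $ i = 0) \<and> (\<forall>i. i \<in> J \<longrightarrow> 0 \<le> v $ i)}"
    by (auto simp: coord_orthant_def coord_space_def)
  also have "closed \<dots>"
    by (intro closed_Collect_conj closed_Collect_all closed_Collect_imp open_Collect_const
        closed_Collect_eq closed_Collect_le continuous_intros)
  finally show ?thesis .
qed

lemma closed_dual_cone: "closed (dual_cone K)"
proof -
  have "dual_cone K = (\<Inter>x\<in>K. {u. 0 \<le> u \<bullet> x})"
    by (auto simp: dual_cone_def)
  then show ?thesis
    by (auto intro!: closed_INT closed_Collect_le continuous_intros)
qed

lemma inner_subvec: "v \<in> coord_space J \<Longrightarrow> v \<bullet> subvec J y = v \<bullet> (y :: real ^ 'm)"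
  unfolding inner_vec_def by (intro sum.cong) (auto simp: coord_space_def subvec_def)

lemma submatrix_rows_mult_coord_space: "submatrix_rows J A *v x \<in> coord_space J"
  by (simp add: coord_space_def submatrix_rows_def matrix_vector_mult_def)

lemma closed_primal_feasible:
  assumes "closed K"
  shows "closed (primal_feasible A J K y)"
proof -
  have "primal_feasible A J K y =
      K \<inter> {x. \<forall>i. (submatrix_rows J A *v x) $ i \<le> subvec J y $ i}"
    by (auto simp: primal_feasible_def less_eq_vec_def)
  also have "closed \<dots>"
    by (intro closed_Int assms closed_Collect_all closed_Collect_le continuous_intros)
  finally show ?thesis .
qed

lemma primal_feasible_nonempty:
  assumes "{submatrix_rows J A *v x + s | x s. x \<in> K \<and> s \<in> coord_orthant J} = coord_space J"
  shows "primal_feasible A J K y \<noteq> {}"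
proof -
  have "subvec J y \<in> coord_space J"
    by (simp add: subvec_def coord_space_def)
  then obtain x s where "subvec J y = submatrix_rows J A *v x + s" "x \<in> K" "s \<in> coord_orthant J"
    using assms by blast
  then have "x \<in> primal_feasible A J K y"
    by (auto simp: primal_feasible_def less_eq_vec_def coord_orthant_nonneg)
  then show ?thesis by blast
qed

text \<open>If \<open>u = 0\<close>, then \<open>v\<close> is nonnegative on every
  \<open>submatrix_rows J A *v x + s\<close> with \<open>x\<close> in \<open>K\<close> and
  \<open>s\<close> in the orthant. By surjectivity \<open>- v\<close> has this form, which forces
  \<open>v = 0\<close> against the normalisation.\<close>

lemma dual_feasible_norm_pos:
  assumes surj: "{submatrix_rows J A *v x + s | x s. x \<in> K \<and> s \<in> coord_orthant J} = coord_space J"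
    and N: "is_norm N" and M: "is_norm M" and vu: "(v, u) \<in> dual_feasible M A J K"
  shows "0 < dual_norm N u"
proof (rule ccontr)
  assume "\<not> 0 < dual_norm N u"
  then have "u = 0"
    using is_norm_pos[OF is_norm_dual_norm[OF N]] by blast
  with vu have v: "v \<in> coord_orthant J" "dual_norm M v = 1"
    and cone: "transpose (submatrix_rows J A) *v v \<in> dual_cone K"
    by (auto simp: dual_feasible_def)
  have "- v \<in> coord_space J"
    using v(1) by (simp add: coord_orthant_def coord_space_def)
  then obtain x s where xs: "- v = submatrix_rows J A *v x + s" "x \<in> K" "s \<in> coord_orthant J"
    using surj by blast
  have "0 \<le> (transpose (submatrix_rows J A) *v v) \<bullet> x + v \<bullet> s"
    using cone xs(2) coord_orthant_inner_nonneg[OF v(1) xs(3)] by (simp add: dual_cone_def)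
  also have "\<dots> = v \<bullet> (- v)"
    by (simp only: xs(1) inner_transpose_matrix_vector inner_add_right)
  finally have "v = 0"
    using inner_ge_zero[of v] by (metis inner_eq_zero_iff inner_minus_right neg_0_le_iff_le order_antisym)
  then show False
    using v(2) is_norm_zero[OF is_norm_dual_norm[OF M]] by simp
qed

text \<open>The only candidate is \<open>v = 0\<close>, whose dual norm is not 1. Hence the dual
  infimum is infinite and its reciprocal 0, in line with the convention for
  \<open>J = {}\<close>.\<close>

lemma dual_feasible_empty:
  fixes A :: "real ^ 'n ^ 'm"
  assumes M: "is_norm M"
  shows "dual_feasible M A {} K = {}"
proof -
  have "coord_orthant {} = {0 :: real ^ 'm}"
    by (auto simp: coord_orthant_def coord_space_def vec_eq_iff)
  moreover have "dual_norm M 0 = 0"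
    by (rule is_norm_zero[OF is_norm_dual_norm[OF M]])
  ultimately show ?thesis by (auto simp: dual_feasible_def)
qed

text \<open>A normalised coordinate vector serves as \<open>v\<close>; choosing \<open>u\<close> as
  its image under the transpose makes the cone constraint read that 0 is in the dual cone.\<close>

lemma dual_feasible_nonempty:
  fixes A :: "real ^ 'n ^ 'm"
  assumes M: "is_norm M" and "J \<noteq> {}"
  shows "dual_feasible M A J K \<noteq> {}"
proof -
  obtain i where i: "i \<in> J" using assms(2) by blast
  define e :: "real ^ 'm" where "e = axis i 1"
  have D: "is_norm (dual_norm M)" by (rule is_norm_dual_norm[OF M])
  have "e \<noteq> 0" by (simp add: e_def axis_eq_0_iff)
  then have pos: "0 < dual_norm M e"
    by (rule is_norm_pos[OF D])
  define v where "v = (1 / dual_norm M e) *\<^sub>R e"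
  have "dual_norm M v = 1"
    using pos by (simp add: is_norm_scaleR[OF D] v_def)
  moreover have "v \<in> coord_orthant J"
    using i pos by (auto simp: v_def e_def axis_def coord_orthant_def coord_space_def)
  ultimately have "(v, transpose (submatrix_rows J A) *v v) \<in> dual_feasible M A J K"
    by (simp add: dual_feasible_def dual_cone_def)
  then show ?thesis by blast
qed

lemma dual_feasible_arg_min_exists:
  assumes N: "is_norm N" and M: "is_norm M" and "J \<noteq> {}"
  shows "\<exists>p. is_arg_min (\<lambda>(v, u). dual_norm N u) (\<lambda>p. p \<in> dual_feasible M A J K) p"
proof -
  obtain v0 u0 where 0: "(v0, u0) \<in> dual_feasible M A J K"
    using dual_feasible_nonempty[OF M \<open>J \<noteq> {}\<close>] by fastforce
  \<comment> \<open>The normalisation bounds \<open>v\<close>, and truncation at the value of a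
    known feasible pair bounds \<open>u\<close>, so minimising over the compact set \<open>C\<close>
    suffices.\<close>
  define C where "C = ({v. dual_norm M v \<le> 1} \<times> {u. dual_norm N u \<le> dual_norm N u0}) \<inter>
      {p. fst p \<in> coord_orthant J} \<inter> {p. dual_norm M (fst p) = 1} \<inter>
      {p. transpose (submatrix_rows J A) *v fst p - snd p \<in> dual_cone K}"
  have C: "(v, u) \<in> C \<longleftrightarrow> (v, u) \<in> dual_feasible M A J K \<and> dual_norm N u \<le> dual_norm N u0" for v u
    by (auto simp: C_def dual_feasible_def)
  have "compact C"
    unfolding C_def
    by (intro compact_Int_closed compact_Times compact_is_norm_ball is_norm_dual_norm N M
        closed_Collect_eq continuous_on_compose2[OF is_norm_continuous_on[OF is_norm_dual_norm[OF M], of UNIV]]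
        continuous_intros subset_UNIV bounded_linear.continuous_on[OF matrix_vector_mul_bounded_linear]
        closed_vimage[OF closed_coord_orthant, unfolded vimage_def]
        closed_vimage[OF closed_dual_cone, unfolded vimage_def])
  moreover have "C \<noteq> {}" using 0 C by blast
  moreover have "continuous_on C (\<lambda>p. dual_norm N (snd p))"
    by (intro continuous_on_compose2[OF is_norm_continuous_on[OF is_norm_dual_norm[OF N], of UNIV]]
        continuous_intros subset_UNIV)
  ultimately obtain p where "p \<in> C" "\<And>q. q \<in> C \<Longrightarrow> dual_norm N (snd p) \<le> dual_norm N (snd q)"
    using continuous_attains_inf[of C "\<lambda>p. dual_norm N (snd p)"] by blast
  moreover obtain v u where "p = (v, u)" by fastforce
  ultimately have "is_arg_min (\<lambda>(v, u). dual_norm N u) (\<lambda>p. p \<in> dual_feasible M A J K) (v, u)"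
    unfolding is_arg_min_linorder using C by (force split: prod.splits)
  then show ?thesis by blast
qed

section \<open>Weak and strong duality for a single pair\<close>

lemma weak_duality:
  assumes "(v, u) \<in> dual_feasible M A J K" "x \<in> primal_feasible A J K y" "is_norm N"
  shows "- (v \<bullet> y) \<le> dual_norm N u * N x"
proof -
  have v: "v \<in> coord_orthant J" and x: "x \<in> K"
    using assms by (auto simp: dual_feasible_def primal_feasible_def)
  have "0 \<le> (transpose (submatrix_rows J A) *v v - u) \<bullet> x"
    using assms x by (auto simp: dual_feasible_def dual_cone_def)
  then have "u \<bullet> x \<le> v \<bullet> (submatrix_rows J A *v x)"
    by (simp only: inner_diff_left inner_transpose_matrix_vector diff_ge_0_iff_ge)
  also have "\<dots> \<le> v \<bullet> subvec J y"
    using assms(2) v unfolding inner_vec_def primal_feasible_def less_eq_vec_def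
    by (auto intro!: sum_mono mult_left_mono coord_orthant_nonneg)
  also have "\<dots> = v \<bullet> y"
    using v by (intro inner_subvec) (simp add: coord_orthant_def)
  \<comment> \<open>The sign is moved onto \<open>x\<close> because the norm inequality is needed at
    \<open>- x\<close>.\<close>
  finally have "- (v \<bullet> y) \<le> (- u) \<bullet> x" by simp
  also have "\<dots> = u \<bullet> (- x)" by simp
  also have "\<dots> \<le> dual_norm N u * N (- x)"
    by (rule inner_le_dual_norm_mult[OF assms(3)])
  also have "N (- x) = N x"
    by (rule is_norm_minus[OF assms(3)])
  finally show ?thesis .
qed

text \<open>
  If no \<open>x \<in> K\<close> of norm at most \<open>1 / r\<close> were feasible, then \<open>y\<^sub>J\<close> could be strictly
  separated from the closed convex set \<open>C\<close> below; the normal vector \<open>v\<close> would lie in the orthant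
  and complete to a dual feasible pair of value below \<open>r\<close>.
\<close>

lemma primal_feasible_small:
  fixes A :: "real ^ 'n ^ 'm"
  assumes N: "is_norm N" and M: "is_norm M"
    and K: "closed K" "convex K" "cone K" "0 \<in> K"
    and "0 < r" and r: "\<And>v u. (v, u) \<in> dual_feasible M A J K \<Longrightarrow> r \<le> dual_norm N u"
    and y: "M y \<le> 1"
  shows "\<exists>x\<in>primal_feasible A J K y. N x \<le> 1 / r"
proof (rule ccontr)
  assume none: "\<not> ?thesis"
  define B where "B = submatrix_rows J A"
  define P where "P = {x. N x \<le> 1 / r} \<inter> K"
  \<comment> \<open>These are the right-hand sides on \<open>J\<close> that some \<open>x\<close> in
    \<open>K\<close> of norm at most \<open>1 / r\<close> can meet with nonnegative slack.
    \<open>C\<close> is closed as the sum of a compact and a closed set, so strict separation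
    applies.\<close>
  define C where "C = (\<Union>c\<in>(*v) B ` P. \<Union>s\<in>coord_orthant J. {c + s})"
  have DN: "is_norm (dual_norm N)" and DM: "is_norm (dual_norm M)"
    using is_norm_dual_norm N M by blast+
  note N0 = is_norm_zero[OF N]
  have convP: "convex P"
    unfolding P_def
    by (intro convex_Int convex_is_norm_ball N K(2))
  have "compact P"
    unfolding P_def by (intro compact_Int_closed compact_is_norm_ball N K(1))
  then have "compact ((*v) B ` P)"
    by (intro compact_continuous_image continuous_intros)
  then have "closed C"
    unfolding C_def by (rule compact_closed_sums[OF _ closed_coord_orthant])
  moreover have "convex (coord_orthant J :: (real ^ 'm) set)"
    by (auto simp: convex_alt coord_orthant_def coord_space_def)
  then have "convex C"
    unfolding C_def
    by (intro convex_sums convex_linear_image convP matrix_vector_mul_linear)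
  moreover have C: "B *v x + s \<in> C" if "x \<in> K" "N x \<le> 1 / r" "s \<in> coord_orthant J" for x s
    using that unfolding C_def P_def by blast
  moreover have "subvec J y \<notin> C"
  proof
    assume "subvec J y \<in> C"
    then obtain x s where "x \<in> P" "s \<in> coord_orthant J" "subvec J y = B *v x + s"
      unfolding C_def by blast
    then have "x \<in> primal_feasible A J K y"
      by (auto simp: primal_feasible_def less_eq_vec_def B_def P_def coord_orthant_nonneg)
    then show False
      using none \<open>x \<in> P\<close> unfolding P_def by blast
  qed
  ultimately obtain w b where wb: "w \<bullet> subvec J y < b" "\<And>c. c \<in> C \<Longrightarrow> b < w \<bullet> c"
    using separating_hyperplane_closed_point by metis
  \<comment> \<open>Both \<open>C\<close> and \<open>subvec J y\<close> lie in
    \<open>coord_space J\<close>, so clearing the entries of \<open>w\<close> outside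
    \<open>J\<close> keeps the separation.\<close>
  define v where "v = subvec J w"
  have inner: "v \<bullet> c = w \<bullet> c" if "c \<in> coord_space J" for c
    using that inner_subvec[of c J w] by (simp add: v_def inner_commute)
  have vx: "b < v \<bullet> (B *v x)" if "x \<in> K" "N x \<le> 1 / r" for x
    using wb(2)[OF C[OF that, of 0]] inner[OF submatrix_rows_mult_coord_space, of A x]
    by (simp add: coord_orthant_def coord_space_def B_def)
  have "b < 0"
    using vx[of 0] K(4) N0 \<open>0 < r\<close> by simp
  have "0 \<le> w $ i" if "i \<in> J" for i
  proof (rule ccontr)
    assume "\<not> 0 \<le> w $ i"
    then have "w $ i < 0" by simp
    \<comment> \<open>The multiple of the axis vector is chosen so that its inner product with
      \<open>w\<close> equals \<open>b\<close>, whereas every point of \<open>C\<close> must lie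
      strictly above \<open>b\<close>.\<close>
    then have "axis i (b / w $ i) \<in> coord_orthant J"
      using that \<open>b < 0\<close> by (auto simp: coord_orthant_def coord_space_def axis_def divide_nonpos_neg)
    then have "b < w \<bullet> axis i (b / w $ i)"
      using wb(2)[OF C[of 0]] K(4) N0 \<open>0 < r\<close> by simp
    then show False
      using \<open>w $ i < 0\<close> by (simp add: inner_axis)
  qed
  then have v: "v \<in> coord_orthant J"
    by (simp add: v_def coord_orthant_def coord_space_def subvec_def)
  \<comment> \<open>The bound \<open>vx\<close> holds for norm at most \<open>1 / r\<close>;
    rescaling \<open>x\<close> to norm exactly \<open>1 / r\<close> makes it homogeneous, as the
    splitting lemma requires.\<close>
  have dom: "- (transpose B *v v) \<bullet> x \<le> - b * r * N x" if "x \<in> K" for x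
  proof (cases "x = 0")
    case False
    then have pos: "0 < N x" by (rule is_norm_pos[OF N])
    define t where "t = 1 / (r * N x)"
    have "t > 0" using pos \<open>0 < r\<close> by (simp add: t_def)
    have "t *\<^sub>R x \<in> K"
      using K(3) that \<open>t > 0\<close> by (simp add: cone_def)
    moreover have "N (t *\<^sub>R x) \<le> 1 / r"
      using pos \<open>0 < r\<close> by (simp add: is_norm_scaleR[OF N] t_def)
    ultimately have "b < t * (v \<bullet> (B *v x))"
      using vx[of "t *\<^sub>R x"] by (simp add: matrix_vector_mult_scaleR)
    then have "b * (r * N x) < v \<bullet> (B *v x)"
      using pos \<open>0 < r\<close> by (simp add: t_def field_simps)
    then show ?thesis
      by (simp only: inner_transpose_matrix_vector inner_minus_left mult_minus_left neg_le_iff_le mult.assoc less_imp_le)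
  qed (simp add: N0)
  have "0 \<le> - b * r"
    using \<open>b < 0\<close> \<open>0 < r\<close> by (simp add: mult_nonpos_nonneg)
  then obtain u where u: "dual_norm N u \<le> - b * r" "u - - (transpose B *v v) \<in> dual_cone K"
    using dominated_on_cone_split[OF N _ K(2-4) dom] by blast
  have yv: "- b < dual_norm M v"
  proof -
    have "w \<bullet> subvec J y = v \<bullet> y"
      using inner[of "subvec J y"] inner_subvec[of v J y] v
      by (simp add: coord_orthant_def coord_space_def subvec_def)
    then have "- b < v \<bullet> (- y)"
      using wb(1) by simp
    also have "\<dots> \<le> dual_norm M v * M (- y)"
      by (rule inner_le_dual_norm_mult[OF M])
    also have "M (- y) = M y"
      by (rule is_norm_minus[OF M])
    also have "dual_norm M v * M y \<le> dual_norm M v"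
      using y dual_norm_nonneg[OF M, of v] by (simp add: mult_left_le)
    finally show ?thesis .
  qed
  then have pos: "0 < dual_norm M v"
    using \<open>b < 0\<close> by simp
  \<comment> \<open>Normalising \<open>v\<close> and reversing the sign of \<open>u\<close> gives a
    dual feasible pair. Its value is at most \<open>- b * r / dual_norm M v\<close>, which
    \<open>yv\<close> makes smaller than \<open>r\<close>.\<close>
  define k where "k = 1 / dual_norm M v"
  have "k > 0" using pos by (simp add: k_def)
  have "dual_norm M (k *\<^sub>R v) = 1"
    using pos by (simp add: is_norm_scaleR[OF DM] k_def)
  moreover have "k *\<^sub>R v \<in> coord_orthant J"
    using v \<open>k > 0\<close> by (auto simp: coord_orthant_def coord_space_def)
  moreover have "transpose B *v (k *\<^sub>R v) - (- k) *\<^sub>R u = k *\<^sub>R (u - - (transpose B *v v))"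
    by (simp add: matrix_vector_mult_scaleR scaleR_add_right)
  then have "transpose B *v (k *\<^sub>R v) - (- k) *\<^sub>R u \<in> dual_cone K"
    using u(2) \<open>k > 0\<close> unfolding dual_cone_def by simp
  ultimately have "r \<le> dual_norm N ((- k) *\<^sub>R u)"
    by (intro r[of "k *\<^sub>R v"]) (simp add: dual_feasible_def B_def)
  also have "\<dots> = dual_norm N u / dual_norm M v"
    using \<open>k > 0\<close> by (simp add: is_norm_scaleR[OF DN] is_norm_minus[OF DN] k_def)
  also have "\<dots> \<le> - b * r / dual_norm M v"
    using u(1) pos by (intro divide_right_mono) simp_all
  finally have "r * dual_norm M v \<le> r * (- b)"
    using pos by (simp add: field_simps)
  then have "dual_norm M v \<le> - b"
    using \<open>0 < r\<close> by (simp only: mult_le_cancel_left_pos)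
  with yv show False
    by simp
qed

text \<open>An explicit maximiser \<open>y\<close> is produced, so the value of the outer supremum
  and its attainment follow together.\<close>

lemma hoffman_pair_duality:
  fixes A :: "real ^ 'n ^ 'm"
  assumes N: "is_norm N" and M: "is_norm M"
    and K: "closed K" "convex K" "cone K" "0 \<in> K"
    and surj: "{submatrix_rows J A *v x + s | x s. x \<in> K \<and> s \<in> coord_orthant J} = coord_space J"
  defines "\<phi> \<equiv> \<lambda>y. INF x\<in>primal_feasible A J K y. ereal (N x)"
  defines "\<delta> \<equiv> 1 / (INF (v, u)\<in>dual_feasible M A J K. ereal (dual_norm N u))"
  obtains y where "M y \<le> 1" "\<phi> y = \<delta>" "\<And>z. M z \<le> 1 \<Longrightarrow> \<phi> z \<le> \<delta>"
proof (cases "J = {}")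
  case True
  have "dual_feasible M A J K = {}"
    by (simp add: True dual_feasible_empty M)
  then have \<delta>: "\<delta> = 0" by (simp add: \<delta>_def top_ereal_def)
  have \<phi>: "\<phi> z = 0" for z
  proof (rule antisym)
    \<comment> \<open>With no rows the constraint is vacuous, so the origin is optimal for every
      right-hand side.\<close>
    have "0 \<in> primal_feasible A J K z"
      using K(4) by (simp add: True primal_feasible_def less_eq_vec_def subvec_def)
    then have "\<phi> z \<le> ereal (N 0)"
      unfolding \<phi>_def by (rule INF_lower)
    then show "\<phi> z \<le> 0"
      by (simp add: is_norm_zero[OF N] zero_ereal_def)
    show "0 \<le> \<phi> z"
      by (auto simp: \<phi>_def is_norm_nonneg[OF N] intro!: INF_greatest)
  qed
  have "M 0 \<le> 1"
    by (simp add: is_norm_zero[OF M])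
  with that \<phi> \<delta> show ?thesis by (metis order_refl)
next
  case False
  obtain v u where min: "is_arg_min (\<lambda>(v, u). dual_norm N u) (\<lambda>p. p \<in> dual_feasible M A J K) (v, u)"
    using dual_feasible_arg_min_exists[OF N M False] by fastforce
  define r where "r = dual_norm N u"
  have vu: "(v, u) \<in> dual_feasible M A J K"
    using min by (simp add: is_arg_min_def)
  have r: "r \<le> dual_norm N u'" if "(v', u') \<in> dual_feasible M A J K" for v' u'
    using min that unfolding is_arg_min_linorder r_def by fastforce
  have "0 < r"
    unfolding r_def by (rule dual_feasible_norm_pos[OF surj N M vu])
  have "(INF p\<in>dual_feasible M A J K. ereal (case p of (v, u) \<Rightarrow> dual_norm N u)) = ereal r"
    using INF_ereal_is_arg_min[OF min] by (simp add: r_def)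
  \<comment> \<open>Only the form changes: here the case distinction on the pair stands outside
    \<open>ereal\<close>.\<close>
  then have "(INF (v, u)\<in>dual_feasible M A J K. ereal (dual_norm N u)) = ereal r"
    by (simp add: case_prod_unfold)
  then have \<delta>: "\<delta> = ereal (1 / r)"
    using \<open>0 < r\<close> by (simp add: \<delta>_def one_ereal_def)
  have le: "\<phi> z \<le> \<delta>" if "M z \<le> 1" for z
    using primal_feasible_small[OF N M K \<open>0 < r\<close> r that]
    unfolding \<phi>_def \<delta> by (meson INF_lower2 ereal_less_eq(3))
  obtain z where z: "M z \<le> 1" "v \<bullet> z = dual_norm M v"
    using dual_norm_attained[OF M] by blast
  have "M (- z) = M z"
    by (rule is_norm_minus[OF M])
  then have Mz: "M (- z) \<le> 1" using z(1) by simp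
  \<comment> \<open>At \<open>- z\<close> the left side of weak duality is
    \<open>v \<bullet> z\<close>, the dual norm of \<open>v\<close>, hence 1.\<close>
  have "\<delta> \<le> \<phi> (- z)"
    unfolding \<phi>_def \<delta>
  proof (rule INF_greatest)
    fix x assume "x \<in> primal_feasible A J K (- z)"
    from weak_duality[OF vu this N] have "1 \<le> r * N x"
      using vu z(2) by (simp add: r_def dual_feasible_def)
    then show "ereal (1 / r) \<le> ereal (N x)"
      using \<open>0 < r\<close> by (simp add: field_simps)
  qed
  with le[OF Mz] Mz le that show ?thesis by (metis antisym)
qed

section \<open>The maximum over all pairs\<close>

lemma finite_is_arg_max_exists:
  fixes f :: "'a \<Rightarrow> 'b::linorder"
  assumes "finite S" "S \<noteq> {}"
  shows "\<exists>x. is_arg_max f (\<lambda>x. x \<in> S) x"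
proof -
  have "Max (f ` S) \<in> f ` S"
    using assms by (intro Max_in) auto
  then obtain x where "x \<in> S" "f x = Max (f ` S)" by force
  then have "is_arg_max f (\<lambda>x. x \<in> S) x"
    using assms(1) by (auto simp: is_arg_max_linorder)
  then show ?thesis by blast
qed

theorem proposition4:
  fixes A :: "real ^ 'n ^ 'm"
    and R :: "(real ^ 'n) set"
    and N :: "real ^ 'n \<Rightarrow> real"
    and M :: "real ^ 'm \<Rightarrow> real"
  assumes "is_norm N"
    and "is_norm M"
    and "polyhedron R"
    and "R \<noteq> {}"
  shows
    "(\<forall>(J, K)\<in>surjective_pairs A R.
        hoffman_pair N M A J K =
          (SUP y\<in>{y. M y \<le> 1}. INF x\<in>primal_feasible A J K y. ereal (N x)) \<and>
        (SUP y\<in>{y. M y \<le> 1}. INF x\<in>primal_feasible A J K y. ereal (N x)) =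
          1 / (INF (v, u)\<in>dual_feasible M A J K. ereal (dual_norm N u)) \<and>
        (\<forall>y. M y \<le> 1 \<longrightarrow> (\<exists>x. is_arg_min N (\<lambda>x. x \<in> primal_feasible A J K y) x)) \<and>
        (\<exists>y. is_arg_max (\<lambda>y. INF x\<in>primal_feasible A J K y. ereal (N x)) (\<lambda>y. M y \<le> 1) y) \<and>
        (J \<noteq> {} \<longrightarrow>
          (\<exists>p. is_arg_min (\<lambda>(v, u). dual_norm N u) (\<lambda>p. p \<in> dual_feasible M A J K) p))) \<and>
     hoffman N M A R =
       (SUP (J, K)\<in>surjective_pairs A R.
          1 / (INF (v, u)\<in>dual_feasible M A J K. ereal (dual_norm N u))) \<and>
     (\<exists>p. is_arg_max (\<lambda>(J, K). hoffman_pair N M A J K) (\<lambda>p. p \<in> surjective_pairs A R) p) \<and>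
     (\<exists>p. is_arg_max
            (\<lambda>(J, K). 1 / (INF (v, u)\<in>dual_feasible M A J K. ereal (dual_norm N u)))
            (\<lambda>p. p \<in> surjective_pairs A R) p)"
proof -
  define \<phi> where "\<phi> = (\<lambda>J K y. INF x\<in>primal_feasible A J K y. ereal (N x))"
  define \<delta> where "\<delta> = (\<lambda>J K. 1 / (INF (v, u)\<in>dual_feasible M A J K. ereal (dual_norm N u)))"
  note NM = assms(1,2)
  have pair: "(SUP y\<in>{y. M y \<le> 1}. \<phi> J K y) = \<delta> J K"
      "hoffman_pair N M A J K = \<delta> J K"
      "M y \<le> 1 \<Longrightarrow> \<exists>x. is_arg_min N (\<lambda>x. x \<in> primal_feasible A J K y) x"
      "\<exists>y. is_arg_max (\<phi> J K) (\<lambda>y. M y \<le> 1) y"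
    if JK: "(J, K) \<in> surjective_pairs A R" for J K y
  proof -
    have "K \<in> tangent_cones R"
      and surj: "{submatrix_rows J A *v x + s | x s. x \<in> K \<and> s \<in> coord_orthant J} = coord_space J"
      using JK by (auto simp: surjective_pairs_def)
    note K = tangent_cones_closed_convex_cone[OF assms(3) this(1)]
    obtain z where z: "M z \<le> 1" "\<phi> J K z = \<delta> J K" "\<And>y. M y \<le> 1 \<Longrightarrow> \<phi> J K y \<le> \<delta> J K"
      using hoffman_pair_duality[OF NM K surj] unfolding \<phi>_def \<delta>_def by blast
    show sup: "(SUP y\<in>{y. M y \<le> 1}. \<phi> J K y) = \<delta> J K"
      using z by (intro antisym SUP_least SUP_upper2[of z]) auto
    show "\<exists>y. is_arg_max (\<phi> J K) (\<lambda>y. M y \<le> 1) y"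
      using z by (auto simp: is_arg_max_linorder intro!: exI[of _ z])
    show "\<exists>x. is_arg_min N (\<lambda>x. x \<in> primal_feasible A J K y) x"
      by (intro is_norm_arg_min_exists assms closed_primal_feasible K primal_feasible_nonempty surj)
    show "hoffman_pair N M A J K = \<delta> J K"
    proof (cases "J = {}")
      case True
      have "dual_feasible M A J K = {}"
        by (simp add: True dual_feasible_empty NM)
      then show ?thesis
        by (simp add: True hoffman_pair_def \<delta>_def top_ereal_def)
    next
      case False
      then show ?thesis
        using sup by (simp add: hoffman_pair_def \<phi>_def)
    qed
  qed
  have "surjective_pairs A R \<subseteq> UNIV \<times> tangent_cones R"
    by (auto simp: surjective_pairs_def)
  then have fin: "finite (surjective_pairs A R)"
    using finite_tangent_cones[OF assms(3)] by (meson finite finite_SigmaI finite_subset)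
  obtain p where "p \<in> R" using assms(4) by blast
  then have T: "tangent_cone R p \<in> tangent_cones R"
    by (simp add: tangent_cones_def)
  \<comment> \<open>For \<open>J = {}\<close> the surjectivity condition only says that 0 is
    reached, which holds at \<open>x = 0\<close>. So the maximum is over a nonempty finite set and
    is attained.\<close>
  have "({}, tangent_cone R p) \<in> surjective_pairs A R"
    using T tangent_cones_closed_convex_cone(4)[OF assms(3) T]
    by (auto simp: surjective_pairs_def coord_orthant_def coord_space_def submatrix_rows_def
        matrix_vector_mult_def vec_eq_iff)
  then have ne: "surjective_pairs A R \<noteq> {}" by blast
  have "hoffman N M A R = (SUP (J, K)\<in>surjective_pairs A R. \<delta> J K)"
    unfolding hoffman_def using pair(2) by (intro SUP_cong) auto
  then show ?thesis
    using pair dual_feasible_arg_min_exists[OF NM] finite_is_arg_max_exists[OF fin ne]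
    unfolding \<phi>_def \<delta>_def by (intro conjI) (auto split: prod.splits)
qed

end
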